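(* Over the axiom system $\mathcal{M}^{-}$ (the Hilbert plane axioms without SAS), none of the principles SAS, SAA, SSS, [PA], [HA] is deducible from the principles [MS], [AB], [SA], [RCT] taken together. That is, for each $\Psi\in\{\mathrm{SAS},\mathrm{SAA},\mathrm{SSS},[\mathrm{PA}],[\mathrm{HA}]\}$, the statement $\Psi$ is not deducible from the axioms of $\mathcal{M}^{-}$ together with [MS], [AB], [SA] and [RCT].
   Context: The axiom system $\mathcal{M}^{-}$ (a Hilbert plane with the SAS axiom removed) has points, lines, incidence, betweenness $A-B-C$, congruence $\equiv$ of segments and congruence $\equiv$ of angles as primitive notions, with axioms: [I1] Two distinct points are incident with a unique line. [I2] Every line is incident with at least two distinct points. [I3] There are three distinct points not all incident with one line. [O1] If $A-B-C$ then $A,B,C$ are distinct and collinear, and $C-B-A$. [O2] For distinct $B,D$ there are points $A,C,E$ on line $BD$ with $A-B-D$, $B-C-D$, $B-D-E$. [O3] Of three distinct collinear points exactly one is between the other two. [O4] For a line $l$ and points $A,B,C$ not on $l$: (i) if $A,B$ are on the same side of $l$ and $B,C$ are on the same side, then $A,C$ are on the same side; (ii) if $A,B$ are on opposite sides and $B,C$ are on opposite sides, then $A,C$ are on the same side. (Distinct points $X,Y$ not on $l$ are on opposite sides of $l$ if segment $XY$ meets $l$, otherwise on the same side; a point is on the same side as itself.) [C1] If $A\neq B$ and $r$ is a ray from $A'$, there is a unique $B'\ne A'$ on $r$ with $AB\equiv A'B'$. [C2] If $AB\equiv CD$ and $AB\equiv EF$ then $CD\equiv EF$; every segment is congruent to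 itself. [C3] If $A-B-C$, $A'-B'-C'$, $AB\equiv A'B'$, $BC\equiv B'C'$, then $AC\equiv A'C'$. [C4] Given an angle $\angle BAC$ and a ray $\overrightarrow{A'B'}$, there is a unique ray $\overrightarrow{A'C'}$ on a given side of line $A'B'$ with $\angle B'A'C'\equiv\angle BAC$. [C5] If $\angle A\equiv\angle B$ and $\angle A\equiv\angle C$ then $\angle B\equiv\angle C$; every angle is congruent to itself. Segments and angles are unordered ($AB=BA$, $\angle ABC=\angle CBA$); an angle consists of two rays with common origin that are neither equal nor opposite. The interior of $\angle ABC$ is the set of points on the same side of line $BA$ as $C$ and on the same side of line $BC$ as $A$. A ray $\overrightarrow{BG}$ is between $\overrightarrow{BA}$ and $\overrightarrow{BC}$ if $G$ is in the interior of $\angle ABC$. Angles $\angle BAD$ and $\angle CAD$ with $B-A-C$ are supplements of each other. Triangles have noncollinear vertices; $\triangle ABC\equiv\triangle DEF$ means that, under $A\mapsto D$, $B\mapsto E$, $C\mapsto F$, all corresponding sides and all corresponding angles are congruent. Principles (universally quantified): SAS: $AB\equiv DE$, $\angle BAC\equiv\angle EDF$, $AC\equiv DF$ imply $\triangle ABC\equiv\triangle DEF$. SSS: $AB\equiv DE$, $BC\equiv EF$, $AC\equiv DF$ imply $\triangle ABC\equiv\triangle DEF$. SAA: $AC\equiv DF$, $\angle BAC\equiv\angle EDF$, $\angle ABC\equiv\angle DEF$ imply $\triangle ABC\equiv\triangle DEF$. [RCT]: Given $\angle ABC\equiv\angle DEF$, for every ray $\overrightarrow{BG}$ between $\overrightarrow{BA}$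 and $\overrightarrow{BC}$ there exists a unique ray $\overrightarrow{EH}$ between $\overrightarrow{ED}$ and $\overrightarrow{EF}$ such that $\angle GBC\equiv\angle HEF$ and $\angle ABG\equiv\angle DEH$. [MS]: Every segment $AB$ has a unique midpoint, i.e. a unique $M$ with $A-M-B$ and $AM\equiv MB$. [AB]: Every angle $\angle BAC$ has a bisector, i.e. a ray $\overrightarrow{AD}$ between $\overrightarrow{AB}$ and $\overrightarrow{AC}$ with $\angle BAD\equiv\angle CAD$. [SA]: Supplements of congruent angles are congruent. [PA] (Pons Asinorum): in a triangle $ABC$, $AB\equiv AC$ implies $\angle ABC\equiv\angle ACB$. [HA]: Two right triangles with congruent hypotenuses and congruent acute angles are congruent, where the right angle is understood to be congruent to the supplement sharing with it the side containing the leg opposite the acute angle. Explicitly: let $\triangle APQ$, $\triangle A'P'Q'$ be triangles and $X,X'$ points with $A-Q-X$, $A'-Q'-X'$, $\angle PQA\equiv\angle PQX$, $\angle P'Q'A'\equiv\angle P'Q'X'$; if $AP\equiv A'P'$ and $\angle PAQ\equiv\angle P'A'Q'$, then $\triangle APQ\equiv\triangle A'P'Q'$. *)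

theory Defs
  imports Main
begin

text \<open>
  Deducibility is formal derivability in classical two-sorted first-order logic with equality:
  one sort of points, one of lines, and the primitive relations of the axiom system.
  The language has no function symbols, so variables are the only terms; a variable is a sort
  together with an index.  The arguments of the atoms are variable indices, of the
  sort fixed by the position (\<open>Inc A l\<close>: the point \<open>A\<close> is incident with the line \<open>l\<close>;
  \<open>Bet A B C\<close>: A-B-C).
\<close>

datatype sort = Point | Line

datatype fm =
    EqP nat nat
  | EqL nat nat
  | Inc nat nat
  | Bet nat nat nat
  | SegCong nat nat nat nat
  | AngCong nat nat nat nat nat nat
  | Fls
  | Imp fm fm
  | All sort nat fm

primrec free :: "fm \<Rightarrow> (sort \<times> nat) set" where
  "free (EqP a b) = {(Point, a), (Point, b)}"
| "free (EqL l m) = {(Line, l), (Line, m)}"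
| "free (Inc a l) = {(Point, a), (Line, l)}"
| "free (Bet a b c) = {(Point, a), (Point, b), (Point, c)}"
| "free (SegCong a b c d) = {(Point, a), (Point, b), (Point, c), (Point, d)}"
| "free (AngCong a b c d e f) =
     {(Point, a), (Point, b), (Point, c), (Point, d), (Point, e), (Point, f)}"
| "free Fls = {}"
| "free (Imp \<phi> \<psi>) = free \<phi> \<union> free \<psi>"
| "free (All s x \<phi>) = free \<phi> - {(s, x)}"

text \<open>\<open>rename s x y t z\<close> is the index of the variable \<open>(t, z)\<close> after replacing \<open>(s, x)\<close> by \<open>(s, y)\<close>.\<close>

definition rename :: "sort \<Rightarrow> nat \<Rightarrow> nat \<Rightarrow> sort \<Rightarrow> nat \<Rightarrow> nat" where
  "rename s x y t z = (if (t, z) = (s, x) then y else z)"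

text \<open>\<open>subst s x y \<phi>\<close> replaces the free occurrences of \<open>(s, x)\<close> in \<open>\<phi>\<close> by \<open>(s, y)\<close>; it is only used
  when \<open>free_for s x y \<phi>\<close> holds, i.e. when no substituted occurrence becomes bound.\<close>

primrec subst :: "sort \<Rightarrow> nat \<Rightarrow> nat \<Rightarrow> fm \<Rightarrow> fm" where
  "subst s x y (EqP a b) = EqP (rename s x y Point a) (rename s x y Point b)"
| "subst s x y (EqL l m) = EqL (rename s x y Line l) (rename s x y Line m)"
| "subst s x y (Inc a l) = Inc (rename s x y Point a) (rename s x y Line l)"
| "subst s x y (Bet a b c) =
     Bet (rename s x y Point a) (rename s x y Point b) (rename s x y Point c)"
| "subst s x y (SegCong a b c d) =
     SegCong (rename s x y Point a) (rename s x y Point b)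
             (rename s x y Point c) (rename s x y Point d)"
| "subst s x y (AngCong a b c d e f) =
     AngCong (rename s x y Point a) (rename s x y Point b) (rename s x y Point c)
             (rename s x y Point d) (rename s x y Point e) (rename s x y Point f)"
| "subst s x y Fls = Fls"
| "subst s x y (Imp \<phi> \<psi>) = Imp (subst s x y \<phi>) (subst s x y \<psi>)"
| "subst s x y (All t z \<phi>) =
     (if (t, z) = (s, x) then All t z \<phi> else All t z (subst s x y \<phi>))"

primrec free_for :: "sort \<Rightarrow> nat \<Rightarrow> nat \<Rightarrow> fm \<Rightarrow> bool" where
  "free_for s x y (EqP a b) = True"
| "free_for s x y (EqL l m) = True"
| "free_for s x y (Inc a l) = True"
| "free_for s x y (Bet a b c) = True"
| "free_for s x y (SegCong a b c d) = True"
| "free_for s x y (AngCong a b c d e f) = True"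
| "free_for s x y Fls = True"
| "free_for s x y (Imp \<phi> \<psi>) = (free_for s x y \<phi> \<and> free_for s x y \<psi>)"
| "free_for s x y (All t z \<phi>) =
     ((s, x) \<notin> free (All t z \<phi>) \<or> ((t, z) \<noteq> (s, y) \<and> free_for s x y \<phi>))"

fun Eq :: "sort \<Rightarrow> nat \<Rightarrow> nat \<Rightarrow> fm" where
  "Eq Point x y = EqP x y"
| "Eq Line x y = EqL x y"

text \<open>Classical natural deduction (as in van Dalen, Logic and Structure), one copy of the
  quantifier and equality rules for each sort.\<close>

inductive deducible :: "fm set \<Rightarrow> fm \<Rightarrow> bool" (infix "\<turnstile>" 50) where
  assumption: "\<phi> \<in> \<Gamma> \<Longrightarrow> \<Gamma> \<turnstile> \<phi>"
| imp_intro: "insert \<phi> \<Gamma> \<turnstile> \<psi> \<Longrightarrow> \<Gamma> \<turnstile> Imp \<phi> \<psi>"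
| imp_elim: "\<Gamma> \<turnstile> Imp \<phi> \<psi> \<Longrightarrow> \<Gamma> \<turnstile> \<phi> \<Longrightarrow> \<Gamma> \<turnstile> \<psi>"
| raa: "insert (Imp \<phi> Fls) \<Gamma> \<turnstile> Fls \<Longrightarrow> \<Gamma> \<turnstile> \<phi>"
| all_intro: "\<Gamma> \<turnstile> \<phi> \<Longrightarrow> (\<And>\<gamma>. \<gamma> \<in> \<Gamma> \<Longrightarrow> (s, x) \<notin> free \<gamma>) \<Longrightarrow> \<Gamma> \<turnstile> All s x \<phi>"
| all_elim: "\<Gamma> \<turnstile> All s x \<phi> \<Longrightarrow> free_for s x y \<phi> \<Longrightarrow> \<Gamma> \<turnstile> subst s x y \<phi>"
| eq_refl: "\<Gamma> \<turnstile> Eq s x x"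
| eq_subst: "\<Gamma> \<turnstile> Eq s x y \<Longrightarrow> \<Gamma> \<turnstile> subst s z x \<phi> \<Longrightarrow> free_for s z x \<phi> \<Longrightarrow> free_for s z y \<phi>
    \<Longrightarrow> \<Gamma> \<turnstile> subst s z y \<phi>"

text \<open>
  Concrete formulas are written with higher-order binders.  A schema is a formula depending on
  the number \<open>n\<close> of enclosing quantifiers, and a quantifier at depth \<open>n\<close> binds the index \<open>n\<close>.
  Hence nested quantifiers never reuse an index, and no index is captured when a schema with
  inner quantifiers (such as \<open>same_side\<close>) is applied to variables bound further out.
\<close>

type_synonym schema = "nat \<Rightarrow> fm"

definition sentence :: "schema \<Rightarrow> fm" where
  "sentence \<phi> = \<phi> 0"

definition fls :: schema where
  "fls = (\<lambda>n. Fls)"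

definition imp :: "schema \<Rightarrow> schema \<Rightarrow> schema" (infixr "\<^bold>\<longrightarrow>" 25) where
  "(\<phi> \<^bold>\<longrightarrow> \<psi>) = (\<lambda>n. Imp (\<phi> n) (\<psi> n))"

definition neg :: "schema \<Rightarrow> schema" ("\<^bold>\<not> _" [40] 40) where
  "(\<^bold>\<not> \<phi>) = (\<phi> \<^bold>\<longrightarrow> fls)"

definition con :: "schema \<Rightarrow> schema \<Rightarrow> schema" (infixr "\<^bold>\<and>" 35) where
  "(\<phi> \<^bold>\<and> \<psi>) = (\<^bold>\<not> (\<phi> \<^bold>\<longrightarrow> \<^bold>\<not> \<psi>))"

definition dis :: "schema \<Rightarrow> schema \<Rightarrow> schema" (infixr "\<^bold>\<or>" 30) where
  "(\<phi> \<^bold>\<or> \<psi>) = (\<^bold>\<not> \<phi> \<^bold>\<longrightarrow> \<psi>)"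

definition all_pt :: "(nat \<Rightarrow> schema) \<Rightarrow> schema" (binder "\<^bold>\<forall>\<^sub>P" 10) where
  "all_pt \<phi> = (\<lambda>n. All Point n (\<phi> n (Suc n)))"

definition all_ln :: "(nat \<Rightarrow> schema) \<Rightarrow> schema" (binder "\<^bold>\<forall>\<^sub>L" 10) where
  "all_ln \<phi> = (\<lambda>n. All Line n (\<phi> n (Suc n)))"

definition ex_pt :: "(nat \<Rightarrow> schema) \<Rightarrow> schema" (binder "\<^bold>\<exists>\<^sub>P" 10) where
  "ex_pt \<phi> = (\<^bold>\<not> (\<^bold>\<forall>\<^sub>P x. \<^bold>\<not> \<phi> x))"

definition ex_ln :: "(nat \<Rightarrow> schema) \<Rightarrow> schema" (binder "\<^bold>\<exists>\<^sub>L" 10) where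
  "ex_ln \<phi> = (\<^bold>\<not> (\<^bold>\<forall>\<^sub>L x. \<^bold>\<not> \<phi> x))"

definition eq_pt :: "nat \<Rightarrow> nat \<Rightarrow> schema" (infix "=\<^sub>P" 50) where
  "(A =\<^sub>P B) = (\<lambda>n. EqP A B)"

definition eq_ln :: "nat \<Rightarrow> nat \<Rightarrow> schema" (infix "=\<^sub>L" 50) where
  "(l =\<^sub>L m) = (\<lambda>n. EqL l m)"

abbreviation neq_pt :: "nat \<Rightarrow> nat \<Rightarrow> schema" (infix "\<noteq>\<^sub>P" 50) where
  "A \<noteq>\<^sub>P B \<equiv> \<^bold>\<not> (A =\<^sub>P B)"

definition ex1_pt :: "(nat \<Rightarrow> schema) \<Rightarrow> schema" (binder "\<^bold>\<exists>!\<^sub>P" 10) where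
  "ex1_pt \<phi> = (\<^bold>\<exists>\<^sub>P x. \<phi> x \<^bold>\<and> (\<^bold>\<forall>\<^sub>P y. \<phi> y \<^bold>\<longrightarrow> y =\<^sub>P x))"

definition ex1_ln :: "(nat \<Rightarrow> schema) \<Rightarrow> schema" (binder "\<^bold>\<exists>!\<^sub>L" 10) where
  "ex1_ln \<phi> = (\<^bold>\<exists>\<^sub>L x. \<phi> x \<^bold>\<and> (\<^bold>\<forall>\<^sub>L y. \<phi> y \<^bold>\<longrightarrow> y =\<^sub>L x))"

definition on :: "nat \<Rightarrow> nat \<Rightarrow> schema" (infix "on" 50) where
  "(A on l) = (\<lambda>n. Inc A l)"

definition bet :: "nat \<Rightarrow> nat \<Rightarrow> nat \<Rightarrow> schema" where
  "bet A B C = (\<lambda>n. Bet A B C)"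

definition seg_cong :: "nat \<times> nat \<Rightarrow> nat \<times> nat \<Rightarrow> schema" (infix "\<cong>\<^sub>S" 50) where
  "s \<cong>\<^sub>S t = (case (s, t) of ((A, B), (C, D)) \<Rightarrow> \<lambda>n. SegCong A B C D)"

definition ang_cong :: "nat \<times> nat \<times> nat \<Rightarrow> nat \<times> nat \<times> nat \<Rightarrow> schema" (infix "\<cong>\<^sub>A" 50) where
  "a \<cong>\<^sub>A b = (case (a, b) of ((A, B, C), (D, E, F)) \<Rightarrow> \<lambda>n. AngCong A B C D E F)"

subsection \<open>Defined notions\<close>

definition collinear_pts :: "nat \<Rightarrow> nat \<Rightarrow> nat \<Rightarrow> schema" where
  "collinear_pts A B C = (\<^bold>\<exists>\<^sub>L l. A on l \<^bold>\<and> B on l \<^bold>\<and> C on l)"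

text \<open>\<open>triangle A B C\<close> also expresses that the rays BA and BC form an angle, i.e. are neither
  equal nor opposite.\<close>

definition triangle :: "nat \<Rightarrow> nat \<Rightarrow> nat \<Rightarrow> schema" where
  "triangle A B C = (\<^bold>\<not> collinear_pts A B C)"

definition opposite_sides :: "nat \<Rightarrow> nat \<Rightarrow> nat \<Rightarrow> schema" where
  "opposite_sides l X Y =
     (X \<noteq>\<^sub>P Y \<^bold>\<and> \<^bold>\<not> X on l \<^bold>\<and> \<^bold>\<not> Y on l \<^bold>\<and> (\<^bold>\<exists>\<^sub>P Z. bet X Z Y \<^bold>\<and> Z on l))"

definition same_side :: "nat \<Rightarrow> nat \<Rightarrow> nat \<Rightarrow> schema" where
  "same_side l X Y =
     (\<^bold>\<not> X on l \<^bold>\<and> \<^bold>\<not> Y on l \<^bold>\<and> (X =\<^sub>P Y \<^bold>\<or> \<^bold>\<not> (\<^bold>\<exists>\<^sub>P Z. bet X Z Y \<^bold>\<and> Z on l)))"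

text \<open>\<open>on_ray X A B\<close>: the point X lies on the ray from A through B (\<open>A \<noteq> B\<close>), which contains A.\<close>

definition on_ray :: "nat \<Rightarrow> nat \<Rightarrow> nat \<Rightarrow> schema" where
  "on_ray X A B = (X =\<^sub>P A \<^bold>\<or> X =\<^sub>P B \<^bold>\<or> bet A X B \<^bold>\<or> bet A B X)"

definition angle_interior :: "nat \<Rightarrow> nat \<Rightarrow> nat \<Rightarrow> nat \<Rightarrow> schema" where
  "angle_interior G A B C =
     ((\<^bold>\<exists>\<^sub>L l. B on l \<^bold>\<and> A on l \<^bold>\<and> same_side l G C) \<^bold>\<and>
      (\<^bold>\<exists>\<^sub>L m. B on m \<^bold>\<and> C on m \<^bold>\<and> same_side m G A))"

definition same_segment :: "nat \<Rightarrow> nat \<Rightarrow> nat \<Rightarrow> nat \<Rightarrow> schema" where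
  "same_segment A B A' B' = ((A' =\<^sub>P A \<^bold>\<and> B' =\<^sub>P B) \<^bold>\<or> (A' =\<^sub>P B \<^bold>\<and> B' =\<^sub>P A))"

definition same_angle :: "nat \<Rightarrow> nat \<Rightarrow> nat \<Rightarrow> nat \<Rightarrow> nat \<Rightarrow> nat \<Rightarrow> schema" where
  "same_angle A B C A' B' C' =
     (B' =\<^sub>P B \<^bold>\<and> A' \<noteq>\<^sub>P B \<^bold>\<and> C' \<noteq>\<^sub>P B \<^bold>\<and>
      ((on_ray A' B A \<^bold>\<and> on_ray C' B C) \<^bold>\<or> (on_ray A' B C \<^bold>\<and> on_ray C' B A)))"

definition triangle_cong :: "nat \<Rightarrow> nat \<Rightarrow> nat \<Rightarrow> nat \<Rightarrow> nat \<Rightarrow> nat \<Rightarrow> schema" where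
  "triangle_cong A B C D E F =
     ((A, B) \<cong>\<^sub>S (D, E) \<^bold>\<and> (B, C) \<cong>\<^sub>S (E, F) \<^bold>\<and> (A, C) \<cong>\<^sub>S (D, F) \<^bold>\<and>
      (B, A, C) \<cong>\<^sub>A (E, D, F) \<^bold>\<and> (A, B, C) \<cong>\<^sub>A (D, E, F) \<^bold>\<and> (A, C, B) \<cong>\<^sub>A (D, F, E))"

subsection \<open>The axioms of the system without SAS\<close>

definition I1 :: fm where
  "I1 = sentence (\<^bold>\<forall>\<^sub>P A B. A \<noteq>\<^sub>P B \<^bold>\<longrightarrow> (\<^bold>\<exists>!\<^sub>L l. A on l \<^bold>\<and> B on l))"

definition I2 :: fm where
  "I2 = sentence (\<^bold>\<forall>\<^sub>L l. \<^bold>\<exists>\<^sub>P A B. A \<noteq>\<^sub>P B \<^bold>\<and> A on l \<^bold>\<and> B on l)"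

definition I3 :: fm where
  "I3 = sentence (\<^bold>\<exists>\<^sub>P A B C. A \<noteq>\<^sub>P B \<^bold>\<and> A \<noteq>\<^sub>P C \<^bold>\<and> B \<noteq>\<^sub>P C \<^bold>\<and> \<^bold>\<not> collinear_pts A B C)"

definition O1 :: fm where
  "O1 = sentence (\<^bold>\<forall>\<^sub>P A B C. bet A B C \<^bold>\<longrightarrow>
     A \<noteq>\<^sub>P B \<^bold>\<and> A \<noteq>\<^sub>P C \<^bold>\<and> B \<noteq>\<^sub>P C \<^bold>\<and> collinear_pts A B C \<^bold>\<and> bet C B A)"

definition O2 :: fm where
  "O2 = sentence (\<^bold>\<forall>\<^sub>P B D. \<^bold>\<forall>\<^sub>L l. B \<noteq>\<^sub>P D \<^bold>\<and> B on l \<^bold>\<and> D on l \<^bold>\<longrightarrow>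
     (\<^bold>\<exists>\<^sub>P A C E. A on l \<^bold>\<and> C on l \<^bold>\<and> E on l \<^bold>\<and> bet A B D \<^bold>\<and> bet B C D \<^bold>\<and> bet B D E))"

definition O3 :: fm where
  "O3 = sentence (\<^bold>\<forall>\<^sub>P A B C. A \<noteq>\<^sub>P B \<^bold>\<and> A \<noteq>\<^sub>P C \<^bold>\<and> B \<noteq>\<^sub>P C \<^bold>\<and> collinear_pts A B C \<^bold>\<longrightarrow>
     (bet B A C \<^bold>\<or> bet A B C \<^bold>\<or> bet A C B) \<^bold>\<and>
     \<^bold>\<not> (bet B A C \<^bold>\<and> bet A B C) \<^bold>\<and> \<^bold>\<not> (bet B A C \<^bold>\<and> bet A C B) \<^bold>\<and> \<^bold>\<not> (bet A B C \<^bold>\<and> bet A C B))"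

definition O4 :: fm where
  "O4 = sentence (\<^bold>\<forall>\<^sub>L l. \<^bold>\<forall>\<^sub>P A B C. \<^bold>\<not> A on l \<^bold>\<and> \<^bold>\<not> B on l \<^bold>\<and> \<^bold>\<not> C on l \<^bold>\<longrightarrow>
     (same_side l A B \<^bold>\<and> same_side l B C \<^bold>\<longrightarrow> same_side l A C) \<^bold>\<and>
     (opposite_sides l A B \<^bold>\<and> opposite_sides l B C \<^bold>\<longrightarrow> same_side l A C))"

text \<open>Congruence relates unordered segments and angles made of two rays, whereas the atoms take
  their endpoints, respectively points on the sides, as arguments.  The next two axioms say that
  it depends only on the segments and angles these points represent.\<close>

definition segment_repr :: fm where
  "segment_repr = sentence (\<^bold>\<forall>\<^sub>P A B C D A' B' C' D'.
     A \<noteq>\<^sub>P B \<^bold>\<and> C \<noteq>\<^sub>P D \<^bold>\<and> same_segment A B A' B' \<^bold>\<and> same_segment C D C' D' \<^bold>\<and>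
     (A, B) \<cong>\<^sub>S (C, D) \<^bold>\<longrightarrow> (A', B') \<cong>\<^sub>S (C', D'))"

definition angle_repr :: fm where
  "angle_repr = sentence (\<^bold>\<forall>\<^sub>P A B C D E F A' B' C' D' E' F'.
     triangle A B C \<^bold>\<and> triangle D E F \<^bold>\<and>
     same_angle A B C A' B' C' \<^bold>\<and> same_angle D E F D' E' F' \<^bold>\<and>
     (A, B, C) \<cong>\<^sub>A (D, E, F) \<^bold>\<longrightarrow> (A', B', C') \<cong>\<^sub>A (D', E', F'))"

definition C1 :: fm where
  "C1 = sentence (\<^bold>\<forall>\<^sub>P A B A' R. A \<noteq>\<^sub>P B \<^bold>\<and> A' \<noteq>\<^sub>P R \<^bold>\<longrightarrow>
     (\<^bold>\<exists>!\<^sub>P B'. B' \<noteq>\<^sub>P A' \<^bold>\<and> on_ray B' A' R \<^bold>\<and> (A, B) \<cong>\<^sub>S (A', B')))"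

definition C2 :: fm where
  "C2 = sentence (\<^bold>\<forall>\<^sub>P A B C D E F. A \<noteq>\<^sub>P B \<^bold>\<and> C \<noteq>\<^sub>P D \<^bold>\<and> E \<noteq>\<^sub>P F \<^bold>\<longrightarrow>
     ((A, B) \<cong>\<^sub>S (C, D) \<^bold>\<and> (A, B) \<cong>\<^sub>S (E, F) \<^bold>\<longrightarrow> (C, D) \<cong>\<^sub>S (E, F)) \<^bold>\<and> (A, B) \<cong>\<^sub>S (A, B))"

definition C3 :: fm where
  "C3 = sentence (\<^bold>\<forall>\<^sub>P A B C A' B' C'. bet A B C \<^bold>\<and> bet A' B' C' \<^bold>\<and>
     (A, B) \<cong>\<^sub>S (A', B') \<^bold>\<and> (B, C) \<cong>\<^sub>S (B', C') \<^bold>\<longrightarrow> (A, C) \<cong>\<^sub>S (A', C'))"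

text \<open>The side of the line A'B' in C4 is the one containing the point S.  Uniqueness of the ray
  means that any other point C'' as required lies on the ray A'C'; likewise in RCT.\<close>

definition C4 :: fm where
  "C4 = sentence (\<^bold>\<forall>\<^sub>P B A C B' A' S. \<^bold>\<forall>\<^sub>L l.
     triangle B A C \<^bold>\<and> A' \<noteq>\<^sub>P B' \<^bold>\<and> A' on l \<^bold>\<and> B' on l \<^bold>\<and> \<^bold>\<not> S on l \<^bold>\<longrightarrow>
     (\<^bold>\<exists>\<^sub>P C'. same_side l S C' \<^bold>\<and> (B', A', C') \<cong>\<^sub>A (B, A, C) \<^bold>\<and>
       (\<^bold>\<forall>\<^sub>P C''. same_side l S C'' \<^bold>\<and> (B', A', C'') \<cong>\<^sub>A (B, A, C) \<^bold>\<longrightarrow> on_ray C'' A' C')))"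

definition C5 :: fm where
  "C5 = sentence (\<^bold>\<forall>\<^sub>P A B C D E F G H I. triangle A B C \<^bold>\<and> triangle D E F \<^bold>\<and> triangle G H I \<^bold>\<longrightarrow>
     ((A, B, C) \<cong>\<^sub>A (D, E, F) \<^bold>\<and> (A, B, C) \<cong>\<^sub>A (G, H, I) \<^bold>\<longrightarrow> (D, E, F) \<cong>\<^sub>A (G, H, I)) \<^bold>\<and>
     (A, B, C) \<cong>\<^sub>A (A, B, C))"

definition M_minus :: "fm set" where
  "M_minus = {I1, I2, I3, O1, O2, O3, O4, segment_repr, angle_repr, C1, C2, C3, C4, C5}"

subsection \<open>Principles\<close>

definition SAS :: fm where
  "SAS = sentence (\<^bold>\<forall>\<^sub>P A B C D E F. triangle A B C \<^bold>\<and> triangle D E F \<^bold>\<and>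
     (A, B) \<cong>\<^sub>S (D, E) \<^bold>\<and> (B, A, C) \<cong>\<^sub>A (E, D, F) \<^bold>\<and> (A, C) \<cong>\<^sub>S (D, F) \<^bold>\<longrightarrow>
     triangle_cong A B C D E F)"

definition SSS :: fm where
  "SSS = sentence (\<^bold>\<forall>\<^sub>P A B C D E F. triangle A B C \<^bold>\<and> triangle D E F \<^bold>\<and>
     (A, B) \<cong>\<^sub>S (D, E) \<^bold>\<and> (B, C) \<cong>\<^sub>S (E, F) \<^bold>\<and> (A, C) \<cong>\<^sub>S (D, F) \<^bold>\<longrightarrow>
     triangle_cong A B C D E F)"

definition SAA :: fm where
  "SAA = sentence (\<^bold>\<forall>\<^sub>P A B C D E F. triangle A B C \<^bold>\<and> triangle D E F \<^bold>\<and>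
     (A, C) \<cong>\<^sub>S (D, F) \<^bold>\<and> (B, A, C) \<cong>\<^sub>A (E, D, F) \<^bold>\<and> (A, B, C) \<cong>\<^sub>A (D, E, F) \<^bold>\<longrightarrow>
     triangle_cong A B C D E F)"

definition RCT :: fm where
  "RCT = sentence (\<^bold>\<forall>\<^sub>P A B C D E F. triangle A B C \<^bold>\<and> triangle D E F \<^bold>\<and>
     (A, B, C) \<cong>\<^sub>A (D, E, F) \<^bold>\<longrightarrow>
     (\<^bold>\<forall>\<^sub>P G. angle_interior G A B C \<^bold>\<longrightarrow>
       (\<^bold>\<exists>\<^sub>P H. angle_interior H D E F \<^bold>\<and> (G, B, C) \<cong>\<^sub>A (H, E, F) \<^bold>\<and> (A, B, G) \<cong>\<^sub>A (D, E, H) \<^bold>\<and>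
         (\<^bold>\<forall>\<^sub>P H'. angle_interior H' D E F \<^bold>\<and> (G, B, C) \<cong>\<^sub>A (H', E, F) \<^bold>\<and> (A, B, G) \<cong>\<^sub>A (D, E, H') \<^bold>\<longrightarrow>
           on_ray H' E H))))"

definition MS :: fm where
  "MS = sentence (\<^bold>\<forall>\<^sub>P A B. A \<noteq>\<^sub>P B \<^bold>\<longrightarrow> (\<^bold>\<exists>!\<^sub>P M. bet A M B \<^bold>\<and> (A, M) \<cong>\<^sub>S (M, B)))"

definition AB :: fm where
  "AB = sentence (\<^bold>\<forall>\<^sub>P B A C. triangle B A C \<^bold>\<longrightarrow>
     (\<^bold>\<exists>\<^sub>P D. angle_interior D B A C \<^bold>\<and> (B, A, D) \<cong>\<^sub>A (C, A, D)))"

definition SA :: fm where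
  "SA = sentence (\<^bold>\<forall>\<^sub>P B A C D B' A' C' D'.
     bet B A C \<^bold>\<and> bet B' A' C' \<^bold>\<and> triangle B A D \<^bold>\<and> triangle B' A' D' \<^bold>\<and>
     (B, A, D) \<cong>\<^sub>A (B', A', D') \<^bold>\<longrightarrow> (C, A, D) \<cong>\<^sub>A (C', A', D'))"

definition PA :: fm where
  "PA = sentence (\<^bold>\<forall>\<^sub>P A B C. triangle A B C \<^bold>\<and> (A, B) \<cong>\<^sub>S (A, C) \<^bold>\<longrightarrow>
     (A, B, C) \<cong>\<^sub>A (A, C, B))"

definition HA :: fm where
  "HA = sentence (\<^bold>\<forall>\<^sub>P A P Q A' P' Q' X X'. triangle A P Q \<^bold>\<and> triangle A' P' Q' \<^bold>\<and>
     bet A Q X \<^bold>\<and> bet A' Q' X' \<^bold>\<and>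
     (P, Q, A) \<cong>\<^sub>A (P, Q, X) \<^bold>\<and> (P', Q', A') \<cong>\<^sub>A (P', Q', X') \<^bold>\<and>
     (A, P) \<cong>\<^sub>S (A', P') \<^bold>\<and> (P, A, Q) \<cong>\<^sub>A (P', A', Q') \<^bold>\<longrightarrow>
     triangle_cong A P Q A' P' Q')"

end

theory Submission
  imports Defs Complex_Main
begin

text \<open>
  By soundness it suffices to find one model of the axioms and of MS, AB, SA, RCT in which all five
  other principles fail.  Take the real plane with its usual lines, order and angles, but measure
  segments by the quadratic form \<open>x\<^sup>2 + 4 y\<^sup>2\<close>.  The new length is proportional to the Euclidean one
  along each line, and every axiom or principle assumed speaks about segments within lines or about
  angles only, so it survives.  The five refuted principles link lengths in different directions
  through angles.
\<close>

section \<open>Soundness\<close>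

text \<open>C4, AB and RCT require copying, halving and subtracting angles. The cotangent turns
  these into algebra. It decreases strictly on the angles between 0 and pi and takes every real
  value, so on a given side of a line a ray corresponds to exactly one real number. Lying inside an
  angle becomes an inequality, and a difference of angles follows
  \<open>cot (b - a) = (1 + cot a * cot b) / (cot a - cot b)\<close>. All angle arguments thereby
  reduce to polynomial identities and signs, and halving an angle costs one square root.\<close>

record ('p, 'l) geometry =
  incident :: "'p \<Rightarrow> 'l \<Rightarrow> bool"
  between :: "'p \<Rightarrow> 'p \<Rightarrow> 'p \<Rightarrow> bool"
  seg_eq :: "'p \<Rightarrow> 'p \<Rightarrow> 'p \<Rightarrow> 'p \<Rightarrow> bool"
  ang_eq :: "'p \<Rightarrow> 'p \<Rightarrow> 'p \<Rightarrow> 'p \<Rightarrow> 'p \<Rightarrow> 'p \<Rightarrow> bool"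

primrec sat :: "('p, 'l) geometry \<Rightarrow> (nat \<Rightarrow> 'p) \<Rightarrow> (nat \<Rightarrow> 'l) \<Rightarrow> fm \<Rightarrow> bool" where
  "sat M p q (EqP a b) = (p a = p b)"
| "sat M p q (EqL l m) = (q l = q m)"
| "sat M p q (Inc a l) = incident M (p a) (q l)"
| "sat M p q (Bet a b c) = between M (p a) (p b) (p c)"
| "sat M p q (SegCong a b c d) = seg_eq M (p a) (p b) (p c) (p d)"
| "sat M p q (AngCong a b c d e f) = ang_eq M (p a) (p b) (p c) (p d) (p e) (p f)"
| "sat M p q Fls = False"
| "sat M p q (Imp \<phi> \<psi>) = (sat M p q \<phi> \<longrightarrow> sat M p q \<psi>)"
| "sat M p q (All s x \<phi>) =
     (case s of Point \<Rightarrow> \<forall>a. sat M (p(x := a)) q \<phi> | Line \<Rightarrow> \<forall>l. sat M p (q(x := l)) \<phi>)"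

text \<open>Coincidence lemma: it serves the eigenvariable condition of \<open>all_intro\<close> and
  substitution for a variable that is not free.\<close>

lemma sat_cong_free:
  assumes "\<And>x. (Point, x) \<in> free \<phi> \<Longrightarrow> p x = p' x"
    and "\<And>x. (Line, x) \<in> free \<phi> \<Longrightarrow> q x = q' x"
  shows "sat M p q \<phi> = sat M p' q' \<phi>"
  using assms
proof (induction \<phi> arbitrary: p q p' q')
  case (Imp \<phi> \<psi>)
  have "sat M p q \<phi> = sat M p' q' \<phi>" "sat M p q \<psi> = sat M p' q' \<psi>"
    using Imp.prems by (auto intro!: Imp.IH)
  then show ?case by simp
next
  case (All s x \<phi>)
  show ?case
  proof (cases s)
    case Point
    have "sat M (p(x := a)) q \<phi> = sat M (p'(x := a)) q' \<phi>" for a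
      by (rule All.IH) (use All.prems Point in auto)
    then show ?thesis using Point by simp
  next
    case Line
    have "sat M p (q(x := a)) \<phi> = sat M p' (q'(x := a)) \<phi>" for a
      by (rule All.IH) (use All.prems Line in auto)
    then show ?thesis using Line by simp
  qed
qed auto

lemma subst_not_free: "(s, x) \<notin> free \<phi> \<Longrightarrow> subst s x y \<phi> = \<phi>"
  by (induction \<phi>) (auto simp: rename_def)

lemma sat_subst:
  "free_for s x y \<phi> \<Longrightarrow> sat M p q (subst s x y \<phi>) =
     (case s of Point \<Rightarrow> sat M (p(x := p y)) q \<phi> | Line \<Rightarrow> sat M p (q(x := q y)) \<phi>)"
proof (induction \<phi> arbitrary: p q)
  case (All t z \<phi>)
  show ?case
  proof (cases "(s, x) \<in> free (All t z \<phi>)")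
    case False
    have "sat M p q (All t z \<phi>) = (case s of Point \<Rightarrow> sat M (p(x := p y)) q (All t z \<phi>)
        | Line \<Rightarrow> sat M p (q(x := q y)) (All t z \<phi>))"
      using False by (cases s; simp only: sort.case; intro sat_cong_free) auto
    then show ?thesis using subst_not_free[OF False] by simp
  next
    case True
    \<comment> \<open>The bound variable differs from \<open>(s, x)\<close> and
      \<open>(s, y)\<close>, so the updates commute and the value of \<open>(s, y)\<close> survives
      under the quantifier.\<close>
    then have ne: "(t, z) \<noteq> (s, x)" "(t, z) \<noteq> (s, y)" and "free_for s x y \<phi>"
      using All.prems by auto
    note IH = All.IH[OF this(3)]
    show ?thesis
      using ne IH by (cases s; cases t) (simp_all add: fun_upd_twist)
  qed
qed (cases s; auto simp: rename_def)+

lemma soundness: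
  "\<Gamma> \<turnstile> \<phi> \<Longrightarrow> (\<And>\<gamma>. \<gamma> \<in> \<Gamma> \<Longrightarrow> sat M p q \<gamma>) \<Longrightarrow> sat M p q \<phi>"
proof (induction arbitrary: p q rule: deducible.induct)
  case (imp_intro \<phi> \<Gamma> \<psi>)
  then show ?case by (metis insert_iff sat.simps(8))
next
  case (imp_elim \<Gamma> \<phi> \<psi>)
  then show ?case by simp
next
  case (raa \<phi> \<Gamma>)
  then show ?case by (metis insert_iff sat.simps(7,8))
next
  case (all_intro \<Gamma> \<phi> s x)
  show ?case
  proof (cases s)
    case Point
    \<comment> \<open>By the eigenvariable condition the hypotheses stay true when the value at
      \<open>x\<close> changes; this is why the induction generalises over valuations.\<close>
    have "sat M (p(x := a)) q \<phi>" for a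
    proof (rule all_intro.IH)
      fix \<gamma> assume "\<gamma> \<in> \<Gamma>"
      then show "sat M (p(x := a)) q \<gamma>"
        using all_intro.hyps all_intro.prems Point by (subst sat_cong_free[of \<gamma> _ p _ q]) auto
    qed
    then show ?thesis using Point by simp
  next
    case Line
    have "sat M p (q(x := a)) \<phi>" for a
    proof (rule all_intro.IH)
      fix \<gamma> assume "\<gamma> \<in> \<Gamma>"
      then show "sat M p (q(x := a)) \<gamma>"
        using all_intro.hyps all_intro.prems Line by (subst sat_cong_free[of \<gamma> _ p _ q]) auto
    qed
    then show ?thesis using Line by simp
  qed
next
  case (all_elim \<Gamma> s x \<phi> y)
  from all_elim.IH[OF all_elim.prems] have "sat M p q (All s x \<phi>)" by simp
  then show ?case using all_elim.hyps by (cases s) (auto simp: sat_subst)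
next
  case (eq_refl \<Gamma> s x)
  show ?case by (cases s) auto
next
  case (eq_subst \<Gamma> s x y z \<phi>)
  have "sat M p q (Eq s x y)" "sat M p q (subst s z x \<phi>)"
    using eq_subst by blast+
  then show ?case using eq_subst.hyps by (cases s) (auto simp: sat_subst)
qed blast

section \<open>Semantics of the schemas\<close>

text \<open>Turns a concrete sentence into a statement about the geometry: a quantifier at depth
  \<open>n\<close> assigns index \<open>n\<close>, and lookups are settled by comparing
  depths.\<close>

lemma sat_schema [simp]:
  "sat M p q (fls n) = False"
  "sat M p q ((\<Phi> \<^bold>\<longrightarrow> \<Psi>) n) = (sat M p q (\<Phi> n) \<longrightarrow> sat M p q (\<Psi> n))"
  "sat M p q ((\<^bold>\<not> \<Phi>) n) = (\<not> sat M p q (\<Phi> n))"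
  "sat M p q ((\<Phi> \<^bold>\<and> \<Psi>) n) = (sat M p q (\<Phi> n) \<and> sat M p q (\<Psi> n))"
  "sat M p q ((\<Phi> \<^bold>\<or> \<Psi>) n) = (sat M p q (\<Phi> n) \<or> sat M p q (\<Psi> n))"
  "sat M p q (all_pt \<Theta> n) = (\<forall>a. sat M (p(n := a)) q (\<Theta> n (Suc n)))"
  "sat M p q (all_ln \<Theta> n) = (\<forall>l. sat M p (q(n := l)) (\<Theta> n (Suc n)))"
  "sat M p q (ex_pt \<Theta> n) = (\<exists>a. sat M (p(n := a)) q (\<Theta> n (Suc n)))"
  "sat M p q (ex_ln \<Theta> n) = (\<exists>l. sat M p (q(n := l)) (\<Theta> n (Suc n)))"
  "sat M p q ((A =\<^sub>P B) n) = (p A = p B)"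
  "sat M p q ((l =\<^sub>L m) n) = (q l = q m)"
  "sat M p q ((A on l) n) = incident M (p A) (q l)"
  "sat M p q (bet A B C n) = between M (p A) (p B) (p C)"
  "sat M p q (((A, B) \<cong>\<^sub>S (C, D)) n) = seg_eq M (p A) (p B) (p C) (p D)"
  "sat M p q (((A, B, C) \<cong>\<^sub>A (D, E, F)) n) = ang_eq M (p A) (p B) (p C) (p D) (p E) (p F)"
  by (auto simp: fls_def imp_def neg_def con_def dis_def all_pt_def all_ln_def ex_pt_def ex_ln_def
      eq_pt_def eq_ln_def on_def bet_def seg_cong_def ang_cong_def)

section \<open>The plane\<close>

definition ip :: "complex \<Rightarrow> complex \<Rightarrow> real" where
  "ip u v = Re u * Re v + Im u * Im v"

text \<open>The determinant: its vanishing expresses collinearity, its sign the side of a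
  line.\<close>

definition xp :: "complex \<Rightarrow> complex \<Rightarrow> real" where
  "xp u v = Re u * Im v - Im u * Re v"

text \<open>The cotangent determines an unoriented angle up to congruence; for collinear arguments it has the
  junk value 0, which is harmless because the axioms only constrain genuine angles.\<close>

definition cot_angle :: "complex \<Rightarrow> complex \<Rightarrow> real" where
  "cot_angle u v = ip u v / \<bar>xp u v\<bar>"

text \<open>A squared length. The factor 4 makes \<open>2\<close> and \<open>\<i>\<close> equally
  long, which gives the counterexamples simple coordinates.\<close>

definition qlen :: "complex \<Rightarrow> real" where
  "qlen u = (Re u)\<^sup>2 + 4 * (Im u)\<^sup>2"

text \<open>The second sort needs a type of its own. As lines are point sets, uniqueness in
  \<open>I1\<close> becomes equality of sets.\<close>

typedef line = "{l. \<exists>a b. a \<noteq> b \<and> l = {p. xp (b - a) (p - a) = 0}}"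
  by (intro exI[of _ "{p. xp (1 - 0) (p - 0) = 0}"] CollectI exI[of _ 0] exI[of _ 1]) simp

definition lies :: "complex \<Rightarrow> line \<Rightarrow> bool" where
  "lies p l \<longleftrightarrow> p \<in> Rep_line l"

definition betw :: "complex \<Rightarrow> complex \<Rightarrow> complex \<Rightarrow> bool" where
  "betw a b c \<longleftrightarrow> a \<noteq> c \<and> (\<exists>t. 0 < t \<and> t < 1 \<and> b = a + t *\<^sub>R (c - a))"

definition plane :: "(complex, line) geometry" where
  "plane = \<lparr>incident = lies, between = betw,
     seg_eq = (\<lambda>a b c d. qlen (b - a) = qlen (d - c)),
     ang_eq = (\<lambda>a b c d e f. cot_angle (a - b) (c - b) = cot_angle (d - e) (f - e))\<rparr>"

lemma plane_simps [simp]: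
  "incident plane = lies"
  "between plane = betw"
  "seg_eq plane a b c d \<longleftrightarrow> qlen (b - a) = qlen (d - c)"
  "ang_eq plane a b c d e f \<longleftrightarrow> cot_angle (a - b) (c - b) = cot_angle (d - e) (f - e)"
  by (simp_all add: plane_def)

section \<open>Bilinear algebra of the determinant\<close>

lemma xp_self [simp]: "xp u u = 0"
  by (simp add: xp_def)

lemma xp_scale [simp]:
  "xp (r *\<^sub>R u) v = r * xp u v" "xp u (r *\<^sub>R v) = r * xp u v"
  by (simp_all add: xp_def algebra_simps)

lemma xp_0 [simp]: "xp 0 u = 0" "xp u 0 = 0"
  by (simp_all add: xp_def)

lemma xp_diff:
  "xp (u - v) w = xp u w - xp v w" "xp w (u - v) = xp w u - xp w v"
  by (simp_all add: xp_def algebra_simps)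

lemma xp_add:
  "xp (u + v) w = xp u w + xp v w" "xp w (u + v) = xp w u + xp w v"
  by (simp_all add: xp_def algebra_simps)

lemma xp_commute: "xp v u = - xp u v"
  by (simp add: xp_def)

lemma ip_self_pos: "u \<noteq> 0 \<Longrightarrow> 0 < ip u u"
  by (auto simp: ip_def complex_eq_iff sum_squares_gt_zero_iff)

lemma xp_eq_0_iff:
  assumes "u \<noteq> 0"
  shows "xp u v = 0 \<longleftrightarrow> (\<exists>t. v = t *\<^sub>R u)"
proof
  assume z: "xp u v = 0"
  \<comment> \<open>The expansion of \<open>v\<close> in the orthogonal basis \<open>u\<close>,
    \<open>\<i> * u\<close>; the coefficient of the latter is \<open>xp u v\<close>.\<close>
  have "ip u u * Re v = ip u v * Re u - xp u v * Im u" "ip u u * Im v = ip u v * Im u + xp u v * Re u"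
    by (simp_all add: ip_def xp_def algebra_simps)
  then have "v = (ip u v / ip u u) *\<^sub>R u"
    using ip_self_pos[OF assms] z by (simp add: complex_eq_iff field_simps)
  then show "\<exists>t. v = t *\<^sub>R u" ..
qed auto

text \<open>The type provides an equation from two unnamed points \<open>c\<close>,
  \<open>d\<close>; passing to other points of the line multiplies it by the nonzero factor
  \<open>t - s\<close>.\<close>

lemma lies_iff:
  assumes "lies a l" "lies b l" "a \<noteq> b"
  shows "lies p l \<longleftrightarrow> xp (b - a) (p - a) = 0"
proof -
  obtain c d where cd: "c \<noteq> d" "Rep_line l = {p. xp (d - c) (p - c) = 0}"
    using Rep_line[of l] by auto
  have lies: "lies p l \<longleftrightarrow> (\<exists>t. p - c = t *\<^sub>R (d - c))" for p
    unfolding lies_def cd(2) using cd(1) xp_eq_0_iff[of "d - c" "p - c"] by simp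
  obtain s t where "a - c = s *\<^sub>R (d - c)" "b - c = t *\<^sub>R (d - c)"
    using assms lies by blast
  then have st: "a = c + s *\<^sub>R (d - c)" and "b = c + t *\<^sub>R (d - c)"
    by (metis add.commute diff_add_cancel)+
  then have "s \<noteq> t" using assms(3) by auto
  have ba: "b - a = (t - s) *\<^sub>R (d - c)"
    unfolding \<open>a = _\<close> \<open>b = _\<close> by (simp add: algebra_simps)
  have pa: "p - a = (p - c) - s *\<^sub>R (d - c)"
    unfolding \<open>a = _\<close> by simp
  have "xp (b - a) (p - a) = (t - s) * xp (d - c) (p - c)"
    unfolding ba pa xp_diff(2)[of _ "p - c"] xp_scale xp_self by simp
  then show ?thesis
    using \<open>s \<noteq> t\<close> unfolding lies_def cd(2) by simp
qed

lemma line_exists: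
  assumes "a \<noteq> b"
  obtains l where "lies a l" "lies b l"
proof
  have r: "Rep_line (Abs_line {p. xp (b - a) (p - a) = 0}) = {p. xp (b - a) (p - a) = 0}"
    by (rule Abs_line_inverse) (use assms in blast)
  show "lies a (Abs_line {p. xp (b - a) (p - a) = 0})"
    unfolding lies_def r by simp
  show "lies b (Abs_line {p. xp (b - a) (p - a) = 0})"
    unfolding lies_def r by (simp only: mem_Collect_eq xp_self)
qed

lemma line_points:
  obtains a b where "a \<noteq> b" "lies a l" "lies b l"
proof -
  obtain a b where ab: "a \<noteq> b" "Rep_line l = {p. xp (b - a) (p - a) = 0}"
    using Rep_line[of l] by auto
  have "lies a l" "lies b l"
    unfolding lies_def ab(2) by (simp_all only: mem_Collect_eq xp_self) simp
  then show thesis using that ab(1) by blast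
qed

lemma line_unique:
  assumes "lies a l" "lies b l" "lies a m" "lies b m" "a \<noteq> b"
  shows "l = m"
proof -
  have "Rep_line l = Rep_line m"
    using lies_iff[OF assms(1,2,5)] lies_iff[OF assms(3,4,5)] unfolding lies_def by blast
  then show ?thesis by (simp add: Rep_line_inject)
qed

lemma collinear_iff:
  "(\<exists>l. lies a l \<and> lies b l \<and> lies c l) \<longleftrightarrow> xp (a - b) (c - b) = 0"
proof (cases "a = b")
  case True
  \<comment> \<open>If \<open>b = c\<close>, the auxiliary point \<open>b + 1\<close> supplies a
    line.\<close>
  obtain l where "lies b l" "lies c l"
    using line_exists[of b c] line_exists[of b "b + 1"] by (metis add_cancel_right_right one_neq_zero)
  then show ?thesis using True by auto
next
  case False
  obtain l where l: "lies a l" "lies b l" using line_exists[OF False] .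
  then show ?thesis
    using lies_iff[OF l(2,1), of c] lies_iff[of b _ a c] False by blast
qed

section \<open>Betweenness and rays in coordinates\<close>

lemma betw_distinct: "betw a b c \<Longrightarrow> a \<noteq> b \<and> a \<noteq> c \<and> b \<noteq> c"
  unfolding betw_def
proof (elim conjE exE)
  fix t :: real assume h: "a \<noteq> c" "0 < t" "t < 1" "b = a + t *\<^sub>R (c - a)"
  have "b - c = (1 - t) *\<^sub>R (a - c)" using h(4) by (simp add: algebra_simps)
  then show "a \<noteq> b \<and> a \<noteq> c \<and> b \<noteq> c" using h by auto
qed

lemma betw_sym: "betw a b c \<Longrightarrow> betw c b a"
  unfolding betw_def
proof (elim conjE exE)
  fix t :: real assume h: "a \<noteq> c" "0 < t" "t < 1" "b = a + t *\<^sub>R (c - a)"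
  have "b = c + (1 - t) *\<^sub>R (a - c)" using h(4) by (simp add: algebra_simps)
  then show "c \<noteq> a \<and> (\<exists>t>0. t < 1 \<and> b = c + t *\<^sub>R (a - c))"
    using h by (intro conjI exI[of _ "1 - t"]) auto
qed

lemma betw_commute: "betw c b a \<longleftrightarrow> betw a b c"
  using betw_sym by blast

text \<open>Seen from the middle point, the bounds on the parameter become positivity of a ratio:
  \<open>(1 - t) / t\<close> one way, \<open>1 / (1 + t)\<close> back.\<close>

lemma betw_vec: "betw a b c \<longleftrightarrow> a \<noteq> b \<and> (\<exists>t>0. c - b = t *\<^sub>R (b - a))"
proof
  assume "betw a b c"
  then obtain t where h: "a \<noteq> c" "0 < t" "t < 1" "b = a + t *\<^sub>R (c - a)"
    unfolding betw_def by blast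
  have "c - b = ((1 - t) / t) *\<^sub>R (b - a)"
    using h(2) unfolding h(4) by (simp add: complex_eq_iff field_simps)
  moreover have "(1 - t) / t > 0" using h by simp
  ultimately show "a \<noteq> b \<and> (\<exists>t>0. c - b = t *\<^sub>R (b - a))"
    using betw_distinct[OF \<open>betw a b c\<close>] by blast
next
  assume "a \<noteq> b \<and> (\<exists>t>0. c - b = t *\<^sub>R (b - a))"
  then obtain t where h: "a \<noteq> b" "t > 0" "c - b = t *\<^sub>R (b - a)" by blast
  have c: "c - a = (1 + t) *\<^sub>R (b - a)" using h(3) by (simp add: algebra_simps)
  then have "a \<noteq> c" using h by auto
  moreover have "b = a + (1 / (1 + t)) *\<^sub>R (c - a)"
    unfolding c using h(2) by (simp add: complex_eq_iff)
  ultimately show "betw a b c"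
    unfolding betw_def using h(2) by (intro conjI exI[of _ "1 / (1 + t)"]) auto
qed

text \<open>With \<open>a\<close> at parameter 0 and \<open>b\<close> at 1, the rest of the line
  falls into three open intervals, from which \<open>O3\<close> and rays are read off.\<close>

lemma betw_param:
  assumes "a \<noteq> b" "c = a + t *\<^sub>R (b - a)"
  shows "betw b a c \<longleftrightarrow> t < 0" "betw a c b \<longleftrightarrow> 0 < t \<and> t < 1" "betw a b c \<longleftrightarrow> 1 < t"
proof -
  have inj: "r *\<^sub>R (b - a) = s *\<^sub>R (b - a) \<longleftrightarrow> r = s" for r s :: real
    using assms(1) by simp
  have "betw b a c \<longleftrightarrow> (\<exists>s>0. t *\<^sub>R (b - a) = (- s) *\<^sub>R (b - a))"
    unfolding betw_vec assms(2) using assms(1) by (simp flip: scaleR_minus_right)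
  also have "\<dots> \<longleftrightarrow> t < 0" unfolding inj by (auto intro: exI[of _ "- t"])
  finally show "betw b a c \<longleftrightarrow> t < 0" .
  have "betw a c b \<longleftrightarrow> (\<exists>s. 0 < s \<and> s < 1 \<and> t *\<^sub>R (b - a) = s *\<^sub>R (b - a))"
    unfolding betw_def assms(2) using assms(1) by simp
  then show "betw a c b \<longleftrightarrow> 0 < t \<and> t < 1" unfolding inj by auto
  have "c - b = (t - 1) *\<^sub>R (b - a)" using assms(2) by (simp add: algebra_simps)
  then have "betw a b c \<longleftrightarrow> (\<exists>s>0. (t - 1) *\<^sub>R (b - a) = s *\<^sub>R (b - a))"
    unfolding betw_vec using assms(1) by simp
  then show "betw a b c \<longleftrightarrow> 1 < t" unfolding inj by auto
qed

definition ray :: "complex \<Rightarrow> complex \<Rightarrow> complex \<Rightarrow> bool" where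
  "ray x a b \<longleftrightarrow> x = a \<or> x = b \<or> betw a x b \<or> betw a b x"

lemma ray_iff:
  assumes "a \<noteq> b"
  shows "ray x a b \<longleftrightarrow> (\<exists>t\<ge>0. x - a = t *\<^sub>R (b - a))"
proof
  assume r: "ray x a b"
  show "\<exists>t\<ge>0. x - a = t *\<^sub>R (b - a)"
  proof (cases "x = a \<or> x = b")
    case True
    then show ?thesis by (metis cancel_comm_monoid_add_class.diff_cancel order_refl scale_one scale_zero_left zero_le_one)
  next
    case False
    with r consider "betw a x b" | "betw a b x" unfolding ray_def by blast
    then show ?thesis
    proof cases
      case 1
      then show ?thesis unfolding betw_def by (auto intro: less_imp_le)
    next
      case 2
      then obtain t where "t > 0" "x - b = t *\<^sub>R (b - a)" unfolding betw_vec by blast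
      then show ?thesis by (intro exI[of _ "1 + t"]) (simp add: algebra_simps)
    qed
  qed
next
  assume "\<exists>t\<ge>0. x - a = t *\<^sub>R (b - a)"
  then obtain t where t: "t \<ge> 0" "x - a = t *\<^sub>R (b - a)" by blast
  then have x: "x = a + t *\<^sub>R (b - a)" by (simp add: algebra_simps)
  consider "t = 0" | "t = 1" | "0 < t" "t < 1" | "1 < t" using t(1) by linarith
  then show "ray x a b"
    unfolding ray_def using betw_param[OF assms x] x by cases auto
qed

section \<open>Sides of a line and interiors of angles\<close>

definition sside :: "line \<Rightarrow> complex \<Rightarrow> complex \<Rightarrow> bool" where
  "sside l x y \<longleftrightarrow> \<not> lies x l \<and> \<not> lies y l \<and> (x = y \<or> \<not> (\<exists>z. betw x z y \<and> lies z l))"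

definition oside :: "line \<Rightarrow> complex \<Rightarrow> complex \<Rightarrow> bool" where
  "oside l x y \<longleftrightarrow> x \<noteq> y \<and> \<not> lies x l \<and> \<not> lies y l \<and> (\<exists>z. betw x z y \<and> lies z l)"

text \<open>The determinant is affine in the point, so a segment with endpoints off the line meets
  it exactly when the end values have opposite signs.\<close>

lemma oside_iff:
  assumes "lies a l" "lies b l" "a \<noteq> b"
  shows "oside l x y \<longleftrightarrow> xp (b - a) (x - a) * xp (b - a) (y - a) < 0"
proof -
  define f where "f p = xp (b - a) (p - a)" for p
  have lies: "lies p l \<longleftrightarrow> f p = 0" for p
    using lies_iff[OF assms] by (simp add: f_def)
  have f: "f (x + t *\<^sub>R (y - x)) = (1 - t) * f x + t * f y" for t
    unfolding f_def by (simp add: xp_diff xp_add algebra_simps)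
  have "f x * f y < 0" if os: "oside l x y"
  proof -
    obtain t where t: "0 < t" "t < 1" "(1 - t) * f x + t * f y = 0" "f x \<noteq> 0"
      using os unfolding oside_def betw_def lies using f by auto
    then have "f y = - ((1 - t) / t) * f x" by (simp add: field_simps)
    then have "f x * f y = - ((1 - t) / t) * (f x)\<^sup>2" by (simp add: power2_eq_square)
    then show ?thesis using t by (simp add: mult_neg_pos divide_neg_pos)
  qed
  moreover have "oside l x y" if neg: "f x * f y < 0"
  proof -
    have ne: "f x \<noteq> 0" "f y \<noteq> 0" "x \<noteq> y" using neg by (auto simp: mult_less_0_iff)
    \<comment> \<open>The parameter at which the affine function vanishes.\<close>
    define t where "t = f x / (f x - f y)"
    have "0 < t" "t < 1" "(1 - t) * f x + t * f y = 0"
      using neg unfolding t_def by (auto simp: mult_less_0_iff field_simps)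
    then show ?thesis
      unfolding oside_def betw_def lies using ne
      by (intro conjI exI[of _ "x + t *\<^sub>R (y - x)"]) (auto simp: f)
  qed
  ultimately show ?thesis unfolding f_def by blast
qed

lemma sside_iff:
  assumes "lies a l" "lies b l" "a \<noteq> b"
  shows "sside l x y \<longleftrightarrow> 0 < xp (b - a) (x - a) * xp (b - a) (y - a)"
proof -
  have "sside l x y \<longleftrightarrow> \<not> lies x l \<and> \<not> lies y l \<and> \<not> oside l x y"
    unfolding sside_def oside_def using betw_distinct by blast
  then show ?thesis
    unfolding oside_iff[OF assms] lies_iff[OF assms]
    by (metis linorder_neqE_linordered_idom mult_eq_0_iff order_less_irrefl order.asym)
qed

definition interior_angle :: "complex \<Rightarrow> complex \<Rightarrow> complex \<Rightarrow> complex \<Rightarrow> bool" where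
  "interior_angle g a b c \<longleftrightarrow> (\<exists>l. lies b l \<and> lies a l \<and> sside l g c) \<and>
     (\<exists>m. lies b m \<and> lies c m \<and> sside m g a)"

lemma interior_angle_iff:
  assumes "xp (a - b) (c - b) \<noteq> 0"
  shows "interior_angle g a b c \<longleftrightarrow>
    0 < xp (a - b) (g - b) * xp (a - b) (c - b) \<and> 0 < xp (c - b) (g - b) * xp (c - b) (a - b)"
proof -
  have "b \<noteq> a" "b \<noteq> c" using assms by auto
  have side: "(\<exists>l. lies b l \<and> lies d l \<and> sside l x y) \<longleftrightarrow> 0 < xp (d - b) (x - b) * xp (d - b) (y - b)"
    if bd: "b \<noteq> d" for d x y
  proof -
    obtain l where "lies b l" "lies d l" using line_exists[OF bd] .
    then show ?thesis using sside_iff[OF _ _ bd] by blast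
  qed
  show ?thesis
    unfolding interior_angle_def side[OF \<open>b \<noteq> a\<close>] side[OF \<open>b \<noteq> c\<close>] ..
qed

section \<open>Satisfaction of the defined notions\<close>

lemma sat_triangle [simp]:
  "sat plane p q (triangle A B C n) \<longleftrightarrow> xp (p A - p B) (p C - p B) \<noteq> 0"
  by (simp add: triangle_def collinear_pts_def collinear_iff)

lemma sat_collinear [simp]:
  "sat plane p q (collinear_pts A B C n) \<longleftrightarrow> xp (p A - p B) (p C - p B) = 0"
  by (simp add: collinear_pts_def collinear_iff)

lemma sat_on_ray [simp]:
  "sat plane p q (on_ray X A B n) \<longleftrightarrow> ray (p X) (p A) (p B)"
  by (simp add: on_ray_def ray_def)

text \<open>\<open>same_side\<close> binds the point index \<open>n\<close>; the conditions exclude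
  capture of the arguments.\<close>

lemma sat_same_side [simp]:
  "X \<noteq> n \<Longrightarrow> Y \<noteq> n \<Longrightarrow> sat plane p q (same_side l X Y n) \<longleftrightarrow> sside (q l) (p X) (p Y)"
  by (simp add: same_side_def sside_def)

lemma sat_opposite_sides [simp]:
  "X \<noteq> n \<Longrightarrow> Y \<noteq> n \<Longrightarrow> sat plane p q (opposite_sides l X Y n) \<longleftrightarrow> oside (q l) (p X) (p Y)"
  by (simp add: opposite_sides_def oside_def)

text \<open>Each line quantifier takes depth \<open>n\<close>, so the point bound inside
  \<open>same_side\<close> has index \<open>Suc n\<close>.\<close>

lemma sat_angle_interior [simp]:
  "G \<noteq> Suc n \<Longrightarrow> A \<noteq> Suc n \<Longrightarrow> C \<noteq> Suc n \<Longrightarrow>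
   sat plane p q (angle_interior G A B C n) \<longleftrightarrow> interior_angle (p G) (p A) (p B) (p C)"
  by (simp add: angle_interior_def interior_angle_def)


section \<open>Directions\<close>

text \<open>\<open>dirn s c u\<close> spans the ray on the side \<open>s\<close> (\<open>= \<plusminus>1\<close>) of \<open>u\<close> making with \<open>u\<close> the angle of cotangent \<open>c\<close>.\<close>

definition dirn :: "real \<Rightarrow> real \<Rightarrow> complex \<Rightarrow> complex" where
  "dirn s c u = Complex (c * Re u - s * Im u) (c * Im u + s * Re u)"

lemma ip_scale [simp]: "ip (r *\<^sub>R u) v = r * ip u v" "ip u (r *\<^sub>R v) = r * ip u v"
  by (simp_all add: ip_def algebra_simps)

lemma cot_angle_commute: "cot_angle v u = cot_angle u v"
  by (simp add: cot_angle_def ip_def xp_commute[of v u] mult.commute)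

lemma cot_angle_scale:
  assumes "r > 0"
  shows "cot_angle (r *\<^sub>R u) v = cot_angle u v" "cot_angle u (r *\<^sub>R v) = cot_angle u v"
  using assms by (simp_all add: cot_angle_def abs_mult)

lemma cot_angle_minus: "cot_angle (- u) v = - cot_angle u v"
  by (simp add: cot_angle_def ip_def xp_def minus_divide_left abs_minus_commute)

lemma xp_dirn: "xp u (dirn s c u) = s * ip u u"
  by (simp add: dirn_def xp_def ip_def algebra_simps)

lemma ip_dirn: "ip u (dirn s c u) = c * ip u u"
  by (simp add: dirn_def ip_def algebra_simps)

text \<open>The factor \<open>c - a\<close> shows that cotangents order the rays on one side of
  \<open>u\<close>: the larger the cotangent, the nearer to \<open>u\<close>.\<close>

lemma xp_dirn_dirn: "xp (dirn s c u) (dirn s a u) = s * (c - a) * ip u u"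
  by (simp add: dirn_def xp_def ip_def algebra_simps)

lemma ip_dirn_dirn: "\<bar>s\<bar> = 1 \<Longrightarrow> ip (dirn s c u) (dirn s a u) = (1 + a * c) * ip u u"
proof -
  assume "\<bar>s\<bar> = 1"
  then have "s * s = 1" by (metis abs_mult_self mult_1)
  moreover have "ip (dirn s c u) (dirn s a u) = (s * s + a * c) * ip u u"
    by (simp add: dirn_def ip_def algebra_simps)
  ultimately show ?thesis by simp
qed

lemma cot_angle_dirn:
  assumes "u \<noteq> 0" "\<bar>s\<bar> = 1"
  shows "cot_angle u (dirn s c u) = c"
  using ip_self_pos[OF assms(1)] assms(2) by (simp add: cot_angle_def xp_dirn ip_dirn abs_mult)

text \<open>The orthogonal expansion along \<open>u\<close>, divided by
  \<open>\<bar>xp u v\<bar>\<close>: side and cotangent determine the ray of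
  \<open>v\<close>.\<close>

lemma eq_dirn:
  assumes "xp u v \<noteq> 0"
  obtains k where "k > 0" "v = k *\<^sub>R dirn (sgn (xp u v)) (cot_angle u v) u"
proof
  have u: "u \<noteq> 0" using assms by auto
  show "0 < \<bar>xp u v\<bar> / ip u u" using ip_self_pos[OF u] assms by simp
  have "ip u u * Re v = ip u v * Re u - xp u v * Im u" "ip u u * Im v = ip u v * Im u + xp u v * Re u"
    by (simp_all add: ip_def xp_def algebra_simps)
  moreover have "\<bar>xp u v\<bar> * sgn (xp u v) = xp u v" by (simp add: abs_sgn mult.commute abs_mult_sgn)
  moreover have "\<bar>xp u v\<bar> * cot_angle u v = ip u v" using assms by (simp add: cot_angle_def)
  ultimately show "v = (\<bar>xp u v\<bar> / ip u u) *\<^sub>R dirn (sgn (xp u v)) (cot_angle u v) u"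
    using ip_self_pos[OF u]
    by (simp add: dirn_def complex_eq_iff divide_simps right_diff_distrib distrib_left
        flip: mult.assoc) (simp add: mult.commute)
qed

text \<open>Both vectors share one normal form up to a positive factor. This yields the uniqueness
  of rays in \<open>C4\<close> and \<open>RCT\<close>.\<close>

lemma same_direction:
  assumes "0 < xp u v * xp u w" "cot_angle u v = cot_angle u w"
  obtains k where "k > 0" "w = k *\<^sub>R v"
proof -
  have ne: "xp u v \<noteq> 0" "xp u w \<noteq> 0" and sgn: "sgn (xp u w) = sgn (xp u v)"
    using assms(1) by (auto simp: zero_less_mult_iff)
  obtain k l where k: "k > 0" "v = k *\<^sub>R dirn (sgn (xp u v)) (cot_angle u v) u"
    and l: "l > 0" "w = l *\<^sub>R dirn (sgn (xp u v)) (cot_angle u v) u"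
    using eq_dirn[OF ne(1)] eq_dirn[OF ne(2)] unfolding sgn assms(2) by metis
  have "w = (l / k) *\<^sub>R v" by (subst k(2), subst l(2)) (use k(1) in simp)
  then show thesis using that[of "l / k"] k(1) l(1) by simp
qed

text \<open>Angle subtraction, with \<open>g\<close> and \<open>v\<close> on one side of
  \<open>u\<close>: the ray of \<open>g\<close> is the inner one iff its angle with \<open>u\<close>
  is smaller, i.e. its cotangent larger, and the remaining angle is then the difference.\<close>

lemma cot_angle_diff:
  assumes "0 < xp u g * xp u v"
  shows "0 < xp v g * xp v u \<longleftrightarrow> cot_angle u v < cot_angle u g"
    and "cot_angle u v < cot_angle u g \<Longrightarrow> cot_angle g v =
      (1 + cot_angle u g * cot_angle u v) / (cot_angle u g - cot_angle u v)"
proof -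
  define s where "s = sgn (xp u v)"
  define a where "a = cot_angle u g"
  define c where "c = cot_angle u v"
  have ne: "xp u g \<noteq> 0" "xp u v \<noteq> 0" and sgn: "sgn (xp u g) = s"
    using assms by (auto simp: zero_less_mult_iff s_def)
  have s: "\<bar>s\<bar> = 1" using ne by (simp add: s_def abs_sgn_eq)
  then have ss: "s * s = 1" by (metis abs_mult_self mult_1)
  have "u \<noteq> 0" using ne by auto
  note pos = ip_self_pos[OF this]
  obtain k where k: "k > 0" "g = k *\<^sub>R dirn s a u" using eq_dirn[OF ne(1)] unfolding sgn a_def .
  obtain l where l: "l > 0" "v = l *\<^sub>R dirn s c u"
    using eq_dirn[OF ne(2)] unfolding s_def c_def .
  define K where "K = k * l * l * ip u u * ip u u"
  have "K > 0" using k(1) l(1) pos by (simp add: K_def)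
  \<comment> \<open>Both factors contain \<open>s\<close>, so the side cancels and the sign of
    \<open>a - c\<close> decides.\<close>
  have "xp v g * xp v u = (s * s) * (K * (a - c))"
    unfolding K_def
    unfolding xp_commute[of v u] unfolding k(2) l(2)
    by (simp add: xp_dirn_dirn xp_dirn algebra_simps)
  then show "0 < xp v g * xp v u \<longleftrightarrow> cot_angle u v < cot_angle u g"
    using \<open>K > 0\<close> unfolding ss a_def[symmetric] c_def[symmetric] by (simp add: zero_less_mult_iff)
  assume "cot_angle u v < cot_angle u g"
  then have "c < a" by (simp add: a_def c_def)
  have "cot_angle g v = cot_angle (dirn s a u) (dirn s c u)"
    unfolding k(2) l(2) using k(1) l(1) by (simp add: cot_angle_scale)
  also have "\<dots> = (1 + a * c) / (a - c)"
    using \<open>c < a\<close> pos s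
    by (simp add: cot_angle_def xp_dirn_dirn ip_dirn_dirn abs_mult mult.commute)
  finally show "cot_angle g v =
      (1 + cot_angle u g * cot_angle u v) / (cot_angle u g - cot_angle u v)"
    by (simp add: a_def c_def)
qed

section \<open>Lengths along a line\<close>

lemma qlen_scale: "qlen (r *\<^sub>R u) = r\<^sup>2 * qlen u"
  by (simp add: qlen_def power_mult_distrib algebra_simps)

lemma qlen_minus: "qlen (- u) = qlen u"
  by (simp add: qlen_def)

lemma qlen_commute: "qlen (a - b) = qlen (b - a)"
  by (metis minus_diff_eq qlen_minus)

lemma qlen_pos: "u \<noteq> 0 \<Longrightarrow> 0 < qlen u"
  by (auto simp: qlen_def complex_eq_iff intro: add_pos_nonneg add_nonneg_pos)

text \<open>Squared lengths do not add, so ratios are compared: the hypotheses force equal positive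
  ratios, and both wholes are the same multiple \<open>1 + t\<close> of their first parts.\<close>

lemma qlen_betw:
  assumes "betw a b c" "betw a' b' c'" "qlen (b - a) = qlen (b' - a')" "qlen (c - b) = qlen (c' - b')"
  shows "qlen (c - a) = qlen (c' - a')"
proof -
  obtain t t' where t: "t > 0" "c - b = t *\<^sub>R (b - a)" "a \<noteq> b"
    and t': "t' > 0" "c' - b' = t' *\<^sub>R (b' - a')" "a' \<noteq> b'"
    using assms(1,2) unfolding betw_vec by blast
  have "t\<^sup>2 = t'\<^sup>2"
    using assms(3,4) qlen_pos[of "b - a"] t(3) unfolding t(2) t'(2) qlen_scale by simp
  then have "t' = t" using t(1) t'(1) by (simp add: power2_eq_iff_nonneg)
  have "c - a = (1 + t) *\<^sub>R (b - a)" "c' - a' = (1 + t) *\<^sub>R (b' - a')"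
    using t(2) t'(2) unfolding \<open>t' = t\<close> by (simp_all add: algebra_simps)
  then show ?thesis using assms(3) by (simp add: qlen_scale)
qed

section \<open>The axioms hold\<close>

lemmas formula_defs = I1_def I2_def I3_def O1_def O2_def O3_def O4_def C1_def C2_def C3_def C4_def C5_def
   segment_repr_def angle_repr_def MS_def AB_def SA_def RCT_def SAS_def SSS_def SAA_def PA_def HA_def
   sentence_def ex1_pt_def ex1_ln_def triangle_cong_def same_segment_def same_angle_def

section \<open>Angles depend only on their rays\<close>

lemma betw_imp_xp: "betw a b c \<Longrightarrow> xp (a - b) (c - b) = 0"
proof -
  assume "betw a b c"
  then obtain t where "c - b = t *\<^sub>R (b - a)" unfolding betw_vec by blast
  then have "c - b = (- t) *\<^sub>R (a - b)" by (simp add: algebra_simps)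
  then show ?thesis by (simp only: xp_scale xp_self)
qed

lemma lies_param: "lies a l \<Longrightarrow> lies b l \<Longrightarrow> a \<noteq> b \<Longrightarrow> lies (a + t *\<^sub>R (b - a)) l"
  by (simp add: lies_iff[of a l b])

lemma ray_direction:
  assumes "ray x a b" "x \<noteq> a" "a \<noteq> b"
  obtains t where "t > 0" "x - a = t *\<^sub>R (b - a)"
proof -
  obtain t where t: "t \<ge> 0" "x - a = t *\<^sub>R (b - a)"
    using assms(1) unfolding ray_iff[OF assms(3)] by blast
  then have "t > 0" using assms(2) by (cases "t = 0") auto
  then show thesis using t(2) by (rule that)
qed

lemma cot_angle_ray:
  assumes "ray a' b a" "ray c' b c" "a' \<noteq> b" "c' \<noteq> b" "xp (a - b) (c - b) \<noteq> 0"
  shows "cot_angle (a' - b) (c' - b) = cot_angle (a - b) (c - b)"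
proof -
  have "b \<noteq> a" "b \<noteq> c" using assms(5) by auto
  then obtain s t where "s > 0" "a' - b = s *\<^sub>R (a - b)" "t > 0" "c' - b = t *\<^sub>R (c - b)"
    using ray_direction[OF assms(1,3)] ray_direction[OF assms(2,4)] by metis
  then show ?thesis by (simp add: cot_angle_scale)
qed

lemma cot_angle_same_angle:
  assumes "ray a' b a \<and> ray c' b c \<or> ray a' b c \<and> ray c' b a" "a' \<noteq> b" "c' \<noteq> b"
    "xp (a - b) (c - b) \<noteq> 0"
  shows "cot_angle (a' - b) (c' - b) = cot_angle (a - b) (c - b)"
  using assms(1)
proof
  assume "ray a' b a \<and> ray c' b c"
  then show ?thesis using cot_angle_ray assms(2-4) by blast
next
  assume "ray a' b c \<and> ray c' b a"
  moreover have "xp (c - b) (a - b) \<noteq> 0" using assms(4) xp_commute[of "c - b" "a - b"] by simp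
  ultimately show ?thesis
    using cot_angle_ray[of a' b c c' a] assms(2,3) cot_angle_commute[of "c - b" "a - b"] by simp
qed

text \<open>Measures the interior from the first arm alone, trading the second side condition for a
  comparison of cotangents.\<close>

lemma interior_angle_cot:
  assumes "xp (a - b) (c - b) \<noteq> 0"
  shows "interior_angle g a b c \<longleftrightarrow> 0 < xp (a - b) (g - b) * xp (a - b) (c - b) \<and>
    cot_angle (a - b) (c - b) < cot_angle (a - b) (g - b)"
  using interior_angle_iff[OF assms] cot_angle_diff(1)[of "a - b" "g - b" "c - b"] by blast

text \<open>Supplies the inner rays of \<open>AB\<close> and \<open>RCT\<close>: every cotangent
  above that of the whole angle is attained inside it, and fixes that of the other part.\<close>

lemma interior_angle_exists:
  assumes "xp (a - b) (c - b) \<noteq> 0" "cot_angle (a - b) (c - b) < x"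
  obtains g where "interior_angle g a b c" "cot_angle (a - b) (g - b) = x"
    "cot_angle (g - b) (c - b) = (1 + x * cot_angle (a - b) (c - b)) / (x - cot_angle (a - b) (c - b))"
proof -
  define u where "u = a - b"
  define s where "s = sgn (xp u (c - b))"
  define g where "g = b + dirn s x u"
  have u: "u \<noteq> 0" and s: "\<bar>s\<bar> = 1" using assms(1) by (auto simp: u_def s_def abs_sgn_eq)
  have g: "cot_angle u (g - b) = x"
    using cot_angle_dirn[OF u s] by (simp add: g_def)
  have "xp u (g - b) * xp u (c - b) = ip u u * \<bar>xp u (c - b)\<bar>"
    by (simp add: g_def xp_dirn s_def abs_sgn mult.commute mult.left_commute)
  then have pos: "0 < xp u (g - b) * xp u (c - b)"
    using ip_self_pos[OF u] assms(1) by (simp add: u_def)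
  show thesis
    using that[of g] interior_angle_cot[OF assms(1), of g] pos g assms(2) cot_angle_diff(2)[OF pos]
    by (simp only: u_def simp_thms)
qed

section \<open>Incidence and order\<close>

lemma plane_I1: "sat plane p q I1"
  unfolding formula_defs
proof simp
  show "\<forall>a b. a \<noteq> b \<longrightarrow> (\<exists>l. lies a l \<and> lies b l \<and> (\<forall>m. lies a m \<and> lies b m \<longrightarrow> m = l))"
    by (metis line_exists line_unique)
qed

lemma plane_I2: "sat plane p q I2"
proof -
  have "\<exists>a b. a \<noteq> b \<and> lies a l \<and> lies b l" for l using line_points[of l] by blast
  then show ?thesis unfolding formula_defs by simp
qed

lemma plane_I3: "sat plane p q I3"
proof -
  have "\<exists>a b c. a \<noteq> b \<and> a \<noteq> c \<and> b \<noteq> c \<and> xp (a - b) (c - b) \<noteq> 0"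
    by (rule exI[of _ 0], rule exI[of _ 1], rule exI[of _ \<i>]) (auto simp: xp_def complex_eq_iff)
  then show ?thesis unfolding formula_defs by simp
qed

lemma plane_O1: "sat plane p q O1"
  unfolding formula_defs by simp (auto dest: betw_distinct betw_imp_xp betw_sym)

lemma plane_O2: "sat plane p q O2"
proof -
  have "\<exists>a c e. lies a l \<and> lies c l \<and> lies e l \<and> betw a b d \<and> betw b c d \<and> betw b d e"
    if h: "b \<noteq> d" "lies b l" "lies d l" for b d l
  proof (intro exI conjI)
    show "lies (b + (- 1) *\<^sub>R (d - b)) l" "lies (b + (1/2) *\<^sub>R (d - b)) l" "lies (b + 2 *\<^sub>R (d - b)) l"
      using lies_param h by blast+
    show "betw (b + (- 1) *\<^sub>R (d - b)) b d"
      using betw_param(1)[OF h(1) refl, of "-1"] betw_sym by simp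
    show "betw b (b + (1/2) *\<^sub>R (d - b)) d" "betw b d (b + 2 *\<^sub>R (d - b))"
      using betw_param(2)[OF h(1) refl, of "1/2"] betw_param(3)[OF h(1) refl, of 2] by simp_all
  qed
  then show ?thesis
    unfolding formula_defs by simp
qed

lemma plane_O3: "sat plane p q O3"
proof -
  have "(betw b a c \<or> betw a b c \<or> betw a c b) \<and> \<not> (betw b a c \<and> betw a b c) \<and>
      \<not> (betw b a c \<and> betw a c b) \<and> \<not> (betw a b c \<and> betw a c b)"
    if h: "a \<noteq> b" "a \<noteq> c" "b \<noteq> c" "xp (a - b) (c - b) = 0" for a b c
  proof -
    obtain t where "c - b = t *\<^sub>R (a - b)" using h(1,4) xp_eq_0_iff[of "a - b" "c - b"] by auto
    then have t: "c = b + t *\<^sub>R (a - b)" by (simp add: algebra_simps)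
    have "t \<noteq> 0" "t \<noteq> 1" using h(2,3) t by auto
    then show ?thesis
      using betw_param[OF h(1)[symmetric] t] betw_commute[of b c a] by auto
  qed
  then show ?thesis
    unfolding formula_defs by simp
qed

text \<open>Plane separation is the sign rule for the values of one determinant at three
  points.\<close>

lemma plane_O4: "sat plane p q O4"
proof -
  have trans: "(sside l x y \<and> sside l y z \<longrightarrow> sside l x z) \<and> (oside l x y \<and> oside l y z \<longrightarrow> sside l x z)"
    for l x y z
  proof -
    obtain a b where ab: "a \<noteq> b" "lies a l" "lies b l" using line_points .
    show ?thesis
      unfolding sside_iff[OF ab(2,3,1)] oside_iff[OF ab(2,3,1)]
      by (auto simp: zero_less_mult_iff mult_less_0_iff)
  qed
  show ?thesis
    unfolding formula_defs by simp (use trans in blast)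
qed

section \<open>Congruence\<close>

lemma plane_segment_repr: "sat plane p q segment_repr"
  unfolding formula_defs
  by simp (intro allI impI, elim conjE disjE, auto simp: qlen_commute)

lemma plane_angle_repr: "sat plane p q angle_repr"
proof -
  have repr: "cot_angle (a' - b) (c' - b) = cot_angle (d' - e) (f' - e)"
    if "xp (a - b) (c - b) \<noteq> 0 \<and> xp (d - e) (f - e) \<noteq> 0 \<and> a' \<noteq> b \<and> c' \<noteq> b \<and>
      (ray a' b a \<and> ray c' b c \<or> ray a' b c \<and> ray c' b a) \<and> d' \<noteq> e \<and> f' \<noteq> e \<and>
      (ray d' e d \<and> ray f' e f \<or> ray d' e f \<and> ray f' e d) \<and>
      cot_angle (a - b) (c - b) = cot_angle (d - e) (f - e)" for a b c d e f a' c' d' f'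
    using cot_angle_same_angle[of a' b a c' c] cot_angle_same_angle[of d' e d f' f] that by argo
  show ?thesis unfolding formula_defs by simp (intro allI impI, rule repr)
qed

lemma plane_C1: "sat plane p q C1"
proof -
  have "\<exists>x. x \<noteq> a' \<and> ray x a' r \<and> qlen (b - a) = qlen (x - a') \<and>
      (\<forall>y. y \<noteq> a' \<and> ray y a' r \<and> qlen (b - a) = qlen (y - a') \<longrightarrow> y = x)"
    if h: "a \<noteq> b" "a' \<noteq> r" for a b a' r
  proof -
    have pos: "qlen (b - a) > 0" "qlen (r - a') > 0" using h qlen_pos by auto
    \<comment> \<open>\<open>qlen\<close> is quadratic, so the scaling factor is the root of the
      quotient.\<close>
    define t where "t = sqrt (qlen (b - a) / qlen (r - a'))"
    have t: "t > 0" "t\<^sup>2 * qlen (r - a') = qlen (b - a)" using pos by (simp_all add: t_def)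
    show ?thesis
    proof (intro exI conjI allI impI)
      show "a' + t *\<^sub>R (r - a') \<noteq> a'" using t(1) h(2) by simp
      show "ray (a' + t *\<^sub>R (r - a')) a' r"
        unfolding ray_iff[OF h(2)] using t(1) by (intro exI[of _ t]) simp
      show "qlen (b - a) = qlen (a' + t *\<^sub>R (r - a') - a')"
        using t(2) by (simp add: qlen_scale)
      fix y assume y: "y \<noteq> a' \<and> ray y a' r \<and> qlen (b - a) = qlen (y - a')"
      then obtain s where s: "s > 0" "y - a' = s *\<^sub>R (r - a')" using ray_direction h(2) by metis
      then have "s\<^sup>2 = t\<^sup>2" using y t(2) pos(2) by (simp add: qlen_scale)
      then have "s = t" using s(1) t(1) by (simp add: power2_eq_iff_nonneg)
      then show "y = a' + t *\<^sub>R (r - a')" using s(2) by (simp add: algebra_simps)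
    qed
  qed
  then show ?thesis
    unfolding formula_defs by simp
qed

lemma plane_C2: "sat plane p q C2"
  unfolding formula_defs by simp

lemma plane_C3: "sat plane p q C3"
  unfolding formula_defs by simp (blast intro: qlen_betw)

text \<open>The given angle enters only through its cotangent \<open>c\<close>, and
  \<open>dirn\<close> realises any real \<open>c\<close> on either side.\<close>

lemma plane_C4: "sat plane p q C4"
proof -
  have "\<exists>x. sside l s x \<and> cot_angle (b - a) (x - a) = c \<and>
      (\<forall>y. sside l s y \<and> cot_angle (b - a) (y - a) = c \<longrightarrow> ray y a x)"
    if h: "a \<noteq> b" "lies a l" "lies b l" "\<not> lies s l" for a b s l c
  proof -
    define f where "f = xp (b - a) (s - a)"
    have f: "f \<noteq> 0" using h lies_iff[OF h(2,3,1)] by (simp add: f_def)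
    define x where "x = a + dirn (sgn f) c (b - a)"
    have "xp (b - a) (s - a) * xp (b - a) (x - a) = \<bar>f\<bar> * ip (b - a) (b - a)"
      unfolding x_def add_diff_cancel_left' xp_dirn f_def[symmetric] by (simp add: abs_sgn)
    then have pos: "0 < xp (b - a) (s - a) * xp (b - a) (x - a)"
      using f ip_self_pos[of "b - a"] h(1) by simp
    have cot: "cot_angle (b - a) (x - a) = c"
      using cot_angle_dirn[of "b - a" "sgn f" c] h(1) f by (simp add: x_def abs_sgn_eq)
    have "ray y a x" if y: "sside l s y \<and> cot_angle (b - a) (y - a) = c" for y
    proof -
      have "0 < xp (b - a) (s - a) * xp (b - a) (y - a)"
        using y sside_iff[OF h(2,3,1)] by blast
      then have "0 < xp (b - a) (x - a) * xp (b - a) (y - a)"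
        using pos by (auto simp: zero_less_mult_iff)
      then obtain k where k: "k > 0" "y - a = k *\<^sub>R (x - a)"
        using same_direction[of "b - a" "x - a" "y - a"] y cot by metis
      have "a \<noteq> x" using pos by auto
      then show ?thesis using k ray_iff by (metis less_imp_le)
    qed
    then show ?thesis using pos cot sside_iff[OF h(2,3,1)] by blast
  qed
  then show ?thesis
    unfolding formula_defs by simp
qed

lemma plane_C5: "sat plane p q C5"
  unfolding formula_defs by simp

section \<open>Midpoints, bisectors, supplements and ray correspondence\<close>

lemma plane_MS: "sat plane p q MS"
proof -
  have "\<exists>m. betw a m b \<and> qlen (m - a) = qlen (b - m) \<and>
      (\<forall>n. betw a n b \<and> qlen (n - a) = qlen (b - n) \<longrightarrow> n = m)" if h: "a \<noteq> b" for a b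
  proof (intro exI conjI allI impI)
    let ?m = "a + (1/2) *\<^sub>R (b - a)"
    show "betw a ?m b" using betw_param(2)[OF h refl] by simp
    have split: "b - (a + t *\<^sub>R (b - a)) = (1 - t) *\<^sub>R (b - a)" for t by (simp add: algebra_simps)
    show "qlen (?m - a) = qlen (b - ?m)" unfolding split by (simp add: qlen_scale)
    fix n assume n: "betw a n b \<and> qlen (n - a) = qlen (b - n)"
    then obtain t where t: "0 < t" "t < 1" "n = a + t *\<^sub>R (b - a)" unfolding betw_def by blast
    then have "t\<^sup>2 = (1 - t)\<^sup>2"
      using n qlen_pos[of "b - a"] h unfolding t(3) split by (simp add: qlen_scale)
    \<comment> \<open>The quadratic terms cancel, leaving a linear equation.\<close>
    then have "t = 1/2" by (simp add: power2_eq_square algebra_simps)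
    then show "n = ?m" using t(3) by simp
  qed
  then show ?thesis
    unfolding formula_defs by simp
qed

text \<open>The half of an angle of cotangent \<open>c\<close> has cotangent \<open>c + sqrt (c\<^sup>2 + 1)\<close>.\<close>

lemma plane_AB: "sat plane p q AB"
proof -
  have "\<exists>d. interior_angle d b a c \<and> cot_angle (b - a) (d - a) = cot_angle (c - a) (d - a)"
    if h: "xp (b - a) (c - a) \<noteq> 0" for a b c
  proof -
    define x where "x = cot_angle (b - a) (c - a)"
    define r where "r = sqrt (x\<^sup>2 + 1)"
    have r: "r > 0" "r * r = x * x + 1"
      by (simp_all add: r_def add_nonneg_pos power2_eq_square)
    obtain d where d: "interior_angle d b a c" "cot_angle (b - a) (d - a) = x + r"
      "cot_angle (d - a) (c - a) = (1 + (x + r) * x) / (x + r - x)"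
      using interior_angle_exists[OF h, of "x + r"] r(1) unfolding x_def by auto
    \<comment> \<open>Equality of the two halves amounts to \<open>r * r = x * x + 1\<close>, which
      is where \<open>r\<close> comes from.\<close>
    have "(1 + (x + r) * x) / (x + r - x) = x + r"
      using r by (simp add: divide_simps) (simp add: algebra_simps)
    then show ?thesis using d cot_angle_commute[of "c - a" "d - a"] by metis
  qed
  then show ?thesis
    unfolding formula_defs by simp
qed

text \<open>Passing to the supplement reverses one arm and so negates the cotangent.\<close>

lemma plane_SA: "sat plane p q SA"
proof -
  have supp: "cot_angle (c - a) v = - cot_angle (b - a) v" if bac: "betw b a c" for a b c v
  proof -
    obtain t where t: "t > 0" "c - a = t *\<^sub>R (a - b)" using bac unfolding betw_vec by blast
    then have "cot_angle (c - a) v = cot_angle (- (b - a)) v" by (simp add: cot_angle_scale)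
    then show ?thesis by (simp only: cot_angle_minus)
  qed
  show ?thesis
    unfolding formula_defs by simp (intro allI impI, elim conjE, simp only: supp)
qed

text \<open>The cotangent of one part is copied into the second angle; as the whole angles agree,
  the subtraction formula makes the other parts agree too.\<close>

lemma plane_RCT: "sat plane p q RCT"
proof -
  have "\<exists>h. interior_angle h d e f \<and>
      cot_angle (g - b) (c - b) = cot_angle (h - e) (f - e) \<and>
      cot_angle (a - b) (g - b) = cot_angle (d - e) (h - e) \<and>
      (\<forall>h'. interior_angle h' d e f \<and>
        cot_angle (g - b) (c - b) = cot_angle (h' - e) (f - e) \<and>
        cot_angle (a - b) (g - b) = cot_angle (d - e) (h' - e) \<longrightarrow> ray h' e h)"
    if abc: "xp (a - b) (c - b) \<noteq> 0" and def: "xp (d - e) (f - e) \<noteq> 0"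
      and eq: "cot_angle (a - b) (c - b) = cot_angle (d - e) (f - e)"
      and g: "interior_angle g a b c" for a b c d e f g
  proof -
    define x where "x = cot_angle (a - b) (g - b)"
    have gx: "0 < xp (a - b) (g - b) * xp (a - b) (c - b)" "cot_angle (d - e) (f - e) < x"
      using g unfolding interior_angle_cot[OF abc] x_def eq by blast+
    obtain h where h: "interior_angle h d e f" "cot_angle (d - e) (h - e) = x"
      "cot_angle (h - e) (f - e) = (1 + x * cot_angle (d - e) (f - e)) / (x - cot_angle (d - e) (f - e))"
      using interior_angle_exists[OF def gx(2)] .
    have "cot_angle (g - b) (c - b) = cot_angle (h - e) (f - e)"
      using cot_angle_diff(2)[OF gx(1)] gx(2) unfolding h(3) eq x_def by blast
    moreover have "ray h' e h"
      if h': "interior_angle h' d e f" "x = cot_angle (d - e) (h' - e)" for h'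
    proof -
      have pos: "0 < xp (d - e) (h - e) * xp (d - e) (f - e)" "0 < xp (d - e) (h' - e) * xp (d - e) (f - e)"
        using h(1) h'(1) unfolding interior_angle_cot[OF def] by blast+
      then have "0 < xp (d - e) (h - e) * xp (d - e) (h' - e)"
        by (auto simp: zero_less_mult_iff)
      then obtain k where k: "k > 0" "h' - e = k *\<^sub>R (h - e)"
        using same_direction[of "d - e" "h - e" "h' - e"] h(2) h'(2) by metis
      have "e \<noteq> h" using pos by auto
      then show ?thesis using k ray_iff by (metis less_imp_le)
    qed
    ultimately show ?thesis using h(1,2) unfolding x_def by metis
  qed
  then show ?thesis
    unfolding formula_defs by simp
qed

lemma plane_model: "\<phi> \<in> M_minus \<union> {MS, AB, SA, RCT} \<Longrightarrow> sat plane p q \<phi>"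
  unfolding M_minus_def Un_insert_left Un_insert_right
  using plane_I1 plane_I2 plane_I3 plane_O1 plane_O2 plane_O3 plane_O4 plane_segment_repr
    plane_angle_repr plane_C1 plane_C2 plane_C3 plane_C4 plane_C5 plane_MS plane_AB plane_SA plane_RCT
  by (elim UnE insertE emptyE) simp_all

section \<open>The principles fail\<close>

text \<open>The triangle with vertices \<open>0\<close>, \<open>2\<close>, \<open>\<i>\<close> is isosceles for \<open>qlen\<close> with unequal base angles, so
  comparing it with its mirror image refutes SAS and SSS as well.\<close>

lemma not_plane_PA: "\<not> sat plane p q PA"
proof
  assume "sat plane p q PA"
  \<comment> \<open>Both legs have \<open>qlen\<close> 4, while the base angles have cotangents 2
    and 1/2.\<close>
  from this[unfolded formula_defs, simplified, rule_format, of 0 2 \<i>] show False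
    by (simp add: xp_def ip_def cot_angle_def qlen_def)
qed

lemma not_plane_SAS: "\<not> sat plane p q SAS"
proof
  assume "sat plane p q SAS"
  from this[unfolded formula_defs, simplified, rule_format, of 0 2 \<i> 0 \<i> 2] show False
    by (simp add: xp_def ip_def cot_angle_def qlen_def)
qed

lemma not_plane_SSS: "\<not> sat plane p q SSS"
proof
  assume "sat plane p q SSS"
  from this[unfolded formula_defs, simplified, rule_format, of 0 2 \<i> 0 \<i> 2] show False
    by (simp add: xp_def ip_def cot_angle_def qlen_def)
qed

text \<open>For SAA and HA, a rotation preserves the angles but changes the ratios of \<open>qlen\<close>.\<close>

lemma not_plane_SAA: "\<not> sat plane p q SAA"
proof
  assume "sat plane p q SAA"
  \<comment> \<open>Two Euclidean isosceles right triangles: the given sides \<open>\<i>\<close> and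
    \<open>2\<close> both have \<open>qlen\<close> 4, but the other legs \<open>1\<close> and
    \<open>2 * \<i>\<close> have 1 and 16.\<close>
  from this[unfolded formula_defs, simplified, rule_format, of 0 1 \<i> 0 "2 * \<i>" 2] show False
    by (simp add: xp_def ip_def cot_angle_def qlen_def)
qed

lemma not_plane_HA: "\<not> sat plane p q HA"
proof
  assume "sat plane p q HA"
  note ha = this[unfolded formula_defs, simplified, rule_format,
      of 0 2 "Complex 1 1" 0 \<i> "Complex (1/2) (1/2)"]
  \<comment> \<open>Doubling the foot of the right angle gives the points X and X' beyond
    it.\<close>
  have b: "betw 0 (Complex 1 1) (Complex 2 2)" "betw 0 (Complex (1/2) (1/2)) (Complex 1 1)"
    unfolding betw_def by (auto simp: complex_eq_iff intro!: exI[of _ "1/2"])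
  \<comment> \<open>The hypotenuse equation is a premise and has been simplified away, so the first
    conjunct compares PQ with P'Q', whose values are 5 and 5/4.\<close>
  have "qlen (Complex 1 1 - 2) = qlen (Complex (1/2) (1/2) - \<i>)"
    by (rule conjunct1[OF ha], intro conjI;
        (rule exI[of _ "Complex 2 2"], intro conjI, rule b(1),
          rule exI[of _ "Complex 1 1"], intro conjI, rule b(2))?;
        simp add: xp_def ip_def cot_angle_def qlen_def power2_eq_square)
  then show False by (simp add: qlen_def power2_eq_square)
qed

theorem mainTheorem3:
  "\<forall>\<Psi> \<in> {SAS, SAA, SSS, PA, HA}. \<not> (M_minus \<union> {MS, AB, SA, RCT} \<turnstile> \<Psi>)"
proof
  fix \<Psi> assume "\<Psi> \<in> {SAS, SAA, SSS, PA, HA}"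
  then have "\<not> sat plane p q \<Psi>" for p q
    using not_plane_SAS not_plane_SAA not_plane_SSS not_plane_PA not_plane_HA by blast
  then show "\<not> (M_minus \<union> {MS, AB, SA, RCT} \<turnstile> \<Psi>)"
    using soundness plane_model by blast
qed

end
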